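(* Consider the zero-lead-time partial backorder system with discount factor $\alpha\in(0,1)$. Both functions $\mathcal{L}^o(\cdot)$ and $\mathcal{C}^{\alpha,o}(r,h;\cdot)$ on the integers are quasi-concave. Further, they have the same global maximizer, given by $$s^{*,\alpha}=\arg\max_{x\in\mathbb{Z}}\mathcal{L}^o(x).$$
   Context: Notation: $x^+=\max\{x,0\}$, $x^-=\max\{-x,0\}$, $x\wedge y=\min(x,y)$, $a_{[i,k]}=\sum_{j=i}^ka_j$ (equal to $0$ if $i>k$). Zero-lead-time partial backorder system. Sale price $r>0$, holding cost $h>0$, patience parameter $p\in[0,1]$. Demands $D_1,D_2,\dots$ are i.i.d. nonnegative integer-valued with finite mean $d$; for each $i$, $\{\xi_{i;\ell}:\ell\ge1\}$ are i.i.d. Bernoulli with mean $p$, independent over $i$ and of the demands. The state at period $i$ is the integer $N_i$ with $(N_i)^+$ the on-hand inventory and $(N_i)^-$ the backorder. In period $i$ an order $Q_i\in\{0,1,2,\dots\}$ depending on $N_i$ is placed and arrives immediately, and then $$N_{i+1}=(N_i+Q_i-D_i)^+-\xi_{i;[1,U_i]},\qquad U_i=(D_i-N_i-Q_i)^+.$$ $\mathcal{A}$ is the set of such policies $\pi=(Q_1,Q_2,\dots)$. The one-period expected profit is $$\mathcal{L}(x,Q)=\mathbb{E}\Big(r\big[Q\wedge x^-+(Q+x)^+\wedge D_1\big]-h(x+Q-D_1)^+\Big),$$ and the optimal discounted profit is $\mathcal{C}^\alpha(r,h;x)=\max_{\pi\in\mathcal{A}}\mathbb{E}\{\sum_{i\ge1}\alpha^{i-1}\mathcal{L}(N_i,Q_i)\mid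 N_1=x\}$. Define $$\mathcal{C}^{\alpha,o}(r,h;x)=\mathcal{C}^\alpha(r,h;x)-rx^-,$$ $$\mathcal{L}^o(x)=-rx^-+\mathbb{E}\Big[r(x^+\wedge D_1)-h(x-D_1)^++\alpha r\big((x-D_1)^+-\xi_{1;[1,(D_1-x)^+]}\big)^-\Big].$$ *)

theory Defs
  imports "HOL-Probability.Probability"
begin

abbreviation pos :: "int \<Rightarrow> int" where "pos x \<equiv> max x 0"

abbreviation neg :: "int \<Rightarrow> int" where "neg x \<equiv> max (- x) 0"

text \<open>Transition out of the post-order level y = N + Q under demand d and patience
  indicators b; the upper limit of the sum is the positive part of d - y.\<close>

definition next_state :: "int \<Rightarrow> nat \<Rightarrow> (nat \<Rightarrow> nat) \<Rightarrow> int" where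
  "next_state y d b = pos (y - int d) - int (\<Sum>l=1..nat (pos (int d - y)). b l)"

text \<open>Periods and patience indicators are numbered from 1. A policy \<pi> orders
  \<pi> i n in period i when the state is n. The value at period 0 is a dummy.\<close>

primrec state ::
  "(nat \<Rightarrow> 'a \<Rightarrow> nat) \<Rightarrow> (nat \<Rightarrow> nat \<Rightarrow> 'a \<Rightarrow> nat) \<Rightarrow> (nat \<Rightarrow> int \<Rightarrow> nat) \<Rightarrow> int \<Rightarrow> nat \<Rightarrow> 'a \<Rightarrow> int" where
  "state D \<xi> \<pi> x 0 \<omega> = x"
| "state D \<xi> \<pi> x (Suc i) \<omega> =
     (if i = 0 then x
      else next_state (state D \<xi> \<pi> x i \<omega> + int (\<pi> i (state D \<xi> \<pi> x i \<omega>)))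
             (D i \<omega>) (\<lambda>l. \<xi> i l \<omega>))"

definition one_period_profit ::
  "'a measure \<Rightarrow> (nat \<Rightarrow> 'a \<Rightarrow> nat) \<Rightarrow> real \<Rightarrow> real \<Rightarrow> int \<Rightarrow> nat \<Rightarrow> real" where
  "one_period_profit M D r h x Q =
     (\<integral>\<omega>. r * real_of_int (min (int Q) (neg x) + min (pos (int Q + x)) (int (D 1 \<omega>)))
         - h * real_of_int (pos (x + int Q - int (D 1 \<omega>))) \<partial>M)"

text \<open>A policy may have expected discounted profit \<open>-\<infinity>\<close> (unbounded holding costs), for which
  the Bochner integral would return 0. The expectation is therefore the extended real one:
  positive part minus negative part, with \<open>ennreal\<close> truncating negative reals to 0. For demands
  of finite mean and discount factor below 1 the positive part is finite, since the backorder in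
  any period is at most the initial backorder plus the total demand so far.\<close>

definition discounted_profit ::
  "'a measure \<Rightarrow> (nat \<Rightarrow> 'a \<Rightarrow> nat) \<Rightarrow> (nat \<Rightarrow> nat \<Rightarrow> 'a \<Rightarrow> nat) \<Rightarrow> real \<Rightarrow> real \<Rightarrow> real \<Rightarrow>
   (nat \<Rightarrow> int \<Rightarrow> nat) \<Rightarrow> int \<Rightarrow> ereal" where
  "discounted_profit M D \<xi> \<alpha> r h \<pi> x =
     (let N = state D \<xi> \<pi> x;
          G = (\<lambda>i \<omega>. \<alpha> ^ (i - 1) * one_period_profit M D r h (N i \<omega>) (\<pi> i (N i \<omega>)))
      in enn2ereal (\<integral>\<^sup>+\<omega>. (\<Sum>i. ennreal (G (Suc i) \<omega>)) \<partial>M)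
       - enn2ereal (\<integral>\<^sup>+\<omega>. (\<Sum>i. ennreal (- G (Suc i) \<omega>)) \<partial>M))"

definition optimal_profit ::
  "'a measure \<Rightarrow> (nat \<Rightarrow> 'a \<Rightarrow> nat) \<Rightarrow> (nat \<Rightarrow> nat \<Rightarrow> 'a \<Rightarrow> nat) \<Rightarrow> real \<Rightarrow> real \<Rightarrow> real \<Rightarrow> int \<Rightarrow> ereal" where
  "optimal_profit M D \<xi> \<alpha> r h x = (SUP \<pi>. discounted_profit M D \<xi> \<alpha> r h \<pi> x)"

definition optimal_profit_o ::
  "'a measure \<Rightarrow> (nat \<Rightarrow> 'a \<Rightarrow> nat) \<Rightarrow> (nat \<Rightarrow> nat \<Rightarrow> 'a \<Rightarrow> nat) \<Rightarrow> real \<Rightarrow> real \<Rightarrow> real \<Rightarrow> int \<Rightarrow> ereal" where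
  "optimal_profit_o M D \<xi> \<alpha> r h x =
     optimal_profit M D \<xi> \<alpha> r h x - ereal (r * real_of_int (neg x))"

definition one_period_profit_o ::
  "'a measure \<Rightarrow> (nat \<Rightarrow> 'a \<Rightarrow> nat) \<Rightarrow> (nat \<Rightarrow> nat \<Rightarrow> 'a \<Rightarrow> nat) \<Rightarrow> real \<Rightarrow> real \<Rightarrow> real \<Rightarrow> int \<Rightarrow> real" where
  "one_period_profit_o M D \<xi> \<alpha> r h x =
     - r * real_of_int (neg x) +
     (\<integral>\<omega>. r * real_of_int (min (pos x) (int (D 1 \<omega>)))
         - h * real_of_int (pos (x - int (D 1 \<omega>)))
         + \<alpha> * r * real_of_int (neg (next_state x (D 1 \<omega>) (\<lambda>l. \<xi> 1 l \<omega>))) \<partial>M)"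

definition quasi_concave :: "(int \<Rightarrow> 'b::linorder) \<Rightarrow> bool" where
  "quasi_concave f \<longleftrightarrow> (\<forall>x y z. x \<le> y \<and> y \<le> z \<longrightarrow> min (f x) (f z) \<le> f y)"

end

(* With a discount factor, moving each sale to a backordered customer to the period in which the
   backorder is created turns the discounted profit into r * x^- plus the discounted sum of
   E L^o(y_i), where y_i is the level after ordering in period i: the terms r * N_i^- telescope.
   Here L^o(y) = (r + h - alpha r p) E min(y, D) - h y + const is concave, because a unit short is
   backordered with probability p independently of everything else. Each term is at most
   max L^o = L^o(s), and ordering up to s whenever the state is at most s attains this bound. From
   any x one can order one unit more and thereby imitate a policy started at x + 1, so C^o is
   nonincreasing, hence quasi-concave. *)

theory Submission
  imports Defs
begin

text \<open>The value of a policy is an extended difference of two integrals of infinite series, so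
  the telescoping is done on finite partial sums of real expectations and leaves the remainder
  \<alpha>^n r E N_{n+1}^-. What controls it is a bound valid for all policies: orders are
  nonnegative, so E N_{n+1}^- grows at most linearly in n. The same bound makes the positive part of
  the profit finite for every policy; an infinite negative part then gives the value -\<infinity>,
  below any bound. Charging r N_{i+1}^- to period i rests on a Wald identity: the number of patience
  indicators added up is random, but it is determined by level and demand, which are independent of
  those indicators, so E N_{i+1}^- = p E U_i. Two facts about s carry the lower bound. First, s
  \<ge> 0, since L^o has slope r (1 - \<alpha> p) > 0 on negative levels; hence a system started at
  s and ordering up to s never exceeds s. Second, L^o(s) \<ge> L^o(0) \<ge> 0, which bounds the loss
  of a single period.\<close>

section \<open>Expected discounted sums\<close>

text \<open>Monotone convergence, applied separately to the positive and the negative parts,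
  exchanges expectation and series. The two finiteness assumptions speak of the sums of the parts of
  each term, exactly as in \<open>discounted_profit\<close>, so the value becomes an ordinary
  convergent series of real expectations.\<close>

lemma expected_series_diff:
  fixes G :: "nat \<Rightarrow> 'a \<Rightarrow> real"
  assumes meas [measurable]: "\<And>i. G i \<in> borel_measurable M"
    and A: "(\<integral>\<^sup>+\<omega>. (\<Sum>i. ennreal (G i \<omega>)) \<partial>M) < \<infinity>"
    and B: "(\<integral>\<^sup>+\<omega>. (\<Sum>i. ennreal (- G i \<omega>)) \<partial>M) < \<infinity>"
  obtains v where "\<And>i. integrable M (G i)" "(\<lambda>i. \<integral>\<omega>. G i \<omega> \<partial>M) sums v"
    "enn2ereal (\<integral>\<^sup>+\<omega>. (\<Sum>i. ennreal (G i \<omega>)) \<partial>M)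
       - enn2ereal (\<integral>\<^sup>+\<omega>. (\<Sum>i. ennreal (- G i \<omega>)) \<partial>M) = ereal v"
proof -
  define a where "a i = (\<integral>\<^sup>+\<omega>. ennreal (G i \<omega>) \<partial>M)" for i
  define b where "b i = (\<integral>\<^sup>+\<omega>. ennreal (- G i \<omega>) \<partial>M)" for i
  have A': "(\<integral>\<^sup>+\<omega>. (\<Sum>i. ennreal (G i \<omega>)) \<partial>M) = (\<Sum>i. a i)"
    unfolding a_def by (rule nn_integral_suminf) measurable
  have B': "(\<integral>\<^sup>+\<omega>. (\<Sum>i. ennreal (- G i \<omega>)) \<partial>M) = (\<Sum>i. b i)"
    unfolding b_def by (rule nn_integral_suminf) measurable
  have fin: "a i < \<infinity>" "b i < \<infinity>" for i
    using ennreal_suminf_lessD[of a \<infinity> i] ennreal_suminf_lessD[of b \<infinity> i] A B A' B' by auto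
  have a': "a i = ennreal (enn2real (a i))" and b': "b i = ennreal (enn2real (b i))" for i
    using fin[of i] by (auto simp: less_top)
  have int: "integrable M (G i)" for i
    using fin[of i] by (auto simp: real_integrable_def a_def b_def less_top)
  have eq: "(\<integral>\<omega>. G i \<omega> \<partial>M) = enn2real (a i) - enn2real (b i)" for i
    using real_lebesgue_integral_def[OF int[of i]] by (simp add: a_def b_def)
  have sa: "summable (\<lambda>i. enn2real (a i))"
    by (rule summable_suminf_not_top) (use A A' a' in \<open>auto simp: less_top\<close>)
  have sb: "summable (\<lambda>i. enn2real (b i))"
    by (rule summable_suminf_not_top) (use B B' b' in \<open>auto simp: less_top\<close>)
  have "(\<Sum>i. a i) = ennreal (\<Sum>i. enn2real (a i))"
    using suminf_ennreal2[OF _ sa] a' by (metis (mono_tags, lifting) enn2real_nonneg suminf_cong)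
  moreover have "(\<Sum>i. b i) = ennreal (\<Sum>i. enn2real (b i))"
    using suminf_ennreal2[OF _ sb] b' by (metis (mono_tags, lifting) enn2real_nonneg suminf_cong)
  moreover have "0 \<le> (\<Sum>i. enn2real (a i))" "0 \<le> (\<Sum>i. enn2real (b i))"
    using sa sb by (auto intro: suminf_nonneg)
  ultimately have "enn2ereal (\<Sum>i. a i) - enn2ereal (\<Sum>i. b i)
      = ereal ((\<Sum>i. enn2real (a i)) - (\<Sum>i. enn2real (b i)))"
    by (simp add: enn2ereal_ennreal)
  moreover have "(\<lambda>i. \<integral>\<omega>. G i \<omega> \<partial>M) sums ((\<Sum>i. enn2real (a i)) - (\<Sum>i. enn2real (b i)))"
    unfolding eq using sa sb by (intro sums_diff summable_sums)
  ultimately show thesis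
    using that int A' B' by metis
qed

text \<open>Expected backorders grow at most linearly, so all bounds on discounted terms have this
  shape.\<close>

lemma summable_affine_discount:
  fixes \<alpha> A B :: real
  assumes "0 \<le> \<alpha>" "\<alpha> < 1"
  shows "summable (\<lambda>n. \<alpha> ^ n * (A + real n * B))"
proof -
  \<comment> \<open>A + n B is rewritten as B (n + 1) + (A - B) to use the derivative of the
    geometric series.\<close>
  have "summable (\<lambda>n. B * (of_nat (Suc n) * \<alpha> ^ n) + (A - B) * \<alpha> ^ n)"
    using assms geometric_deriv_sums[of \<alpha>]
    by (intro summable_add summable_mult) (auto simp: sums_iff summable_geometric)
  then show ?thesis
    by (simp add: algebra_simps)
qed

section \<open>State transitions\<close>

lemma measurable_discrete2:
  fixes f :: "'a \<Rightarrow> 'b::countable" and g :: "'a \<Rightarrow> 'c::countable"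
  assumes "f \<in> M \<rightarrow>\<^sub>M count_space UNIV" "g \<in> M \<rightarrow>\<^sub>M count_space UNIV"
  shows "(\<lambda>\<omega>. H (f \<omega>) (g \<omega>)) \<in> M \<rightarrow>\<^sub>M count_space UNIV"
proof (rule measurable_compose_countable[OF _ assms(1)])
  show "(\<lambda>\<omega>. H i (g \<omega>)) \<in> M \<rightarrow>\<^sub>M count_space UNIV" for i
    by (rule measurable_compose[OF assms(2)]) simp
qed

lemma measurable_sum_count_space:
  fixes f :: "'i \<Rightarrow> 'a \<Rightarrow> nat"
  assumes "\<And>i. i \<in> I \<Longrightarrow> f i \<in> M \<rightarrow>\<^sub>M count_space UNIV"
  shows "(\<lambda>\<omega>. \<Sum>i\<in>I. f i \<omega>) \<in> M \<rightarrow>\<^sub>M count_space UNIV"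
  using assms
proof (induction I rule: infinite_finite_induct)
  case (insert i I)
  then show ?case
    using measurable_discrete2[of "f i" M "\<lambda>\<omega>. \<Sum>i\<in>I. f i \<omega>" "(+)"] by simp
qed simp_all

lemma measurable_next_state:
  assumes Y: "Y \<in> M \<rightarrow>\<^sub>M count_space UNIV" and D: "d \<in> M \<rightarrow>\<^sub>M count_space UNIV"
    and b: "\<And>l. 1 \<le> l \<Longrightarrow> b l \<in> M \<rightarrow>\<^sub>M count_space UNIV"
  shows "(\<lambda>\<omega>. next_state (Y \<omega>) (d \<omega>) (\<lambda>l. b l \<omega>)) \<in> M \<rightarrow>\<^sub>M count_space UNIV"
proof -
  have "(\<lambda>\<omega>. nat (pos (int (d \<omega>) - Y \<omega>))) \<in> M \<rightarrow>\<^sub>M count_space UNIV"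
    using measurable_discrete2[OF Y D, of "\<lambda>y d. nat (pos (int d - y))"] .
  \<comment> \<open>The upper limit of the sum is random; with countably many values it may be fixed
    first.\<close>
  then have "(\<lambda>\<omega>. \<Sum>l=1..nat (pos (int (d \<omega>) - Y \<omega>)). b l \<omega>) \<in> M \<rightarrow>\<^sub>M count_space UNIV"
    by (rule measurable_compose_countable[rotated]) (intro measurable_sum_count_space b, simp)
  then show ?thesis
    using measurable_discrete2[OF measurable_discrete2[OF Y D, of "\<lambda>y d. pos (y - int d)"],
        of _ "\<lambda>u v. u - int v"]
    unfolding next_state_def by blast
qed

text \<open>Stated for arbitrary \<open>D\<close> and \<open>\<xi>\<close> and restricted to periods
  before i, so that it also applies when these are coordinate projections on a product space
  carrying only the past.\<close>

lemma measurable_state: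
  assumes "\<And>j. 1 \<le> j \<Longrightarrow> j < i \<Longrightarrow> D j \<in> M \<rightarrow>\<^sub>M count_space UNIV"
    and "\<And>j l. 1 \<le> j \<Longrightarrow> j < i \<Longrightarrow> 1 \<le> l \<Longrightarrow> \<xi> j l \<in> M \<rightarrow>\<^sub>M count_space UNIV"
  shows "state D \<xi> \<pi> x i \<in> M \<rightarrow>\<^sub>M count_space UNIV"
  using assms
proof (induction i)
  case (Suc i)
  show ?case
  proof (cases "i = 0")
    case False
    have "state D \<xi> \<pi> x i \<in> M \<rightarrow>\<^sub>M count_space UNIV"
      using Suc by simp
    then have "(\<lambda>\<omega>. state D \<xi> \<pi> x i \<omega> + int (\<pi> i (state D \<xi> \<pi> x i \<omega>))) \<in> M \<rightarrow>\<^sub>M count_space UNIV"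
      by (rule measurable_compose) simp
    from measurable_next_state[OF this, of "D i" "\<xi> i"] show ?thesis
      using False Suc.prems by (simp cong: measurable_cong)
  qed simp
qed (simp add: fun_eq_iff cong: measurable_cong)

text \<open>The two sides may live on different sample spaces: this transfers the state from the
  original space to the product space of past variables.\<close>

lemma state_cong:
  assumes "\<And>j. 1 \<le> j \<Longrightarrow> j < i \<Longrightarrow> D j \<omega> = D' j \<omega>'"
    and "\<And>j l. 1 \<le> j \<Longrightarrow> j < i \<Longrightarrow> 1 \<le> l \<Longrightarrow> \<xi> j l \<omega> = \<xi>' j l \<omega>'"
  shows "state D \<xi> \<pi> x i \<omega> = state D' \<xi>' \<pi> x i \<omega>'"
  using assms
proof (induction i)
  case (Suc i)
  have "next_state y d (\<lambda>l. \<xi> i l \<omega>) = next_state y d (\<lambda>l. \<xi>' i l \<omega>')" if "i \<noteq> 0" for y d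
    unfolding next_state_def using Suc.prems(2)[of i] that
    by (intro arg_cong2[where f = "(-)"] arg_cong[where f = int] sum.cong) auto
  then show ?case
    using Suc by simp
qed simp

lemma neg_next_state:
  "neg (next_state y d b) = int (\<Sum>l=1..nat (pos (int d - y)). b l)"
proof (cases "int d \<le> y")
  case False
  then have "next_state y d b = - int (\<Sum>l=1..nat (pos (int d - y)). b l)"
    by (simp add: next_state_def)
  then show ?thesis by linarith
qed (simp add: next_state_def)

lemma next_state_le: "next_state y d b \<le> pos y"
proof -
  have "pos (y - int d) \<le> pos y" by simp
  then show ?thesis
    unfolding next_state_def by linarith
qed

text \<open>A positive part counts the l \<ge> 1 with y + l \<le> d.\<close>

lemma pos_eq_suminf:
  "ennreal (real_of_int (pos (int d - y))) = (\<Sum>l. ennreal (of_bool (y + int (Suc l) \<le> int d)))"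
proof -
  have "(\<Sum>l. ennreal (of_bool (y + int (Suc l) \<le> int d)))
      = (\<Sum>l<nat (pos (int d - y)). ennreal (of_bool (y + int (Suc l) \<le> int d)))"
    by (rule suminf_finite) auto
  also have "\<dots> = (\<Sum>l<nat (pos (int d - y)). 1)"
    by (intro sum.cong) auto
  finally show ?thesis
    by (simp add: ennreal_of_nat_eq_real_of_nat)
qed

text \<open>The random upper limit becomes an indicator in each term of an infinite series. Every
  term is then a function of level and demand times a single patience indicator, so independence can
  be applied term by term.\<close>

lemma neg_next_state_eq_suminf:
  "ennreal (real_of_int (neg (next_state y d b)))
     = (\<Sum>l. ennreal (of_bool (y + int (Suc l) \<le> int d) * real (b (Suc l))))"
proof -
  have "(\<Sum>l. ennreal (of_bool (y + int (Suc l) \<le> int d) * real (b (Suc l))))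
      = (\<Sum>l<nat (pos (int d - y)). ennreal (of_bool (y + int (Suc l) \<le> int d) * real (b (Suc l))))"
    by (rule suminf_finite) auto
  also have "\<dots> = (\<Sum>l<nat (pos (int d - y)). ennreal (real (b (Suc l))))"
    by (intro sum.cong) auto
  also have "\<dots> = ennreal (real (\<Sum>l<nat (pos (int d - y)). b (Suc l)))"
    by simp
  also have "(\<Sum>l<nat (pos (int d - y)). b (Suc l)) = (\<Sum>l=1..nat (pos (int d - y)). b l)"
    by (rule sum.reindex_bij_witness[of _ "\<lambda>l. l - 1" Suc]) auto
  finally show ?thesis
    by (simp add: neg_next_state)
qed

section \<open>One-period quantities\<close>

locale partial_backorder = prob_space M
  for M :: "'a measure" +
  fixes D :: "nat \<Rightarrow> 'a \<Rightarrow> nat" and \<xi> :: "nat \<Rightarrow> nat \<Rightarrow> 'a \<Rightarrow> nat" and r h p \<alpha> :: real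
  assumes r_pos: "r > 0" and h_pos: "h > 0" and p_nonneg: "0 \<le> p" and p_le_1: "p \<le> 1"
    and \<alpha>_pos: "0 < \<alpha>" and \<alpha>_less_1: "\<alpha> < 1"
    and demand_distr: "\<And>i. i \<ge> 1 \<Longrightarrow>
          distr M (count_space UNIV) (D i) = distr M (count_space UNIV) (D 1)"
    and demand_mean: "integrable M (\<lambda>\<omega>. real (D 1 \<omega>))"
    and patience_distr: "\<And>i l. i \<ge> 1 \<Longrightarrow> l \<ge> 1 \<Longrightarrow>
          distr M (count_space UNIV) (\<xi> i l) = measure_pmf (map_pmf of_bool (bernoulli_pmf p))"
    and indep: "indep_vars (\<lambda>_. count_space UNIV)
          (case_sum D (\<lambda>(i, l). \<xi> i l)) ({1..} <+> {1..} \<times> {1..})"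
begin

abbreviation level :: "(nat \<Rightarrow> int \<Rightarrow> nat) \<Rightarrow> int \<Rightarrow> nat \<Rightarrow> 'a \<Rightarrow> int" where
  "level \<pi> x i \<omega> \<equiv> state D \<xi> \<pi> x i \<omega> + int (\<pi> i (state D \<xi> \<pi> x i \<omega>))"

abbreviation mean_demand :: real where
  "mean_demand \<equiv> expectation (\<lambda>\<omega>. real (D 1 \<omega>))"

text \<open>The one functional of the demand to which expected sales, holding cost and shortage all
  reduce. Negative y is allowed on purpose: it makes those formulas uniform in the sign of the
  level.\<close>

definition mean_min_demand :: "int \<Rightarrow> real" where
  "mean_min_demand y = expectation (\<lambda>\<omega>. real_of_int (min y (int (D 1 \<omega>))))"

definition mean_backorder :: "(nat \<Rightarrow> int \<Rightarrow> nat) \<Rightarrow> int \<Rightarrow> nat \<Rightarrow> real" where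
  "mean_backorder \<pi> x i = expectation (\<lambda>\<omega>. real_of_int (neg (state D \<xi> \<pi> x i \<omega>)))"

section \<open>Measurability and marginal laws of demands and patience indicators\<close>

lemma D_measurable: "1 \<le> i \<Longrightarrow> D i \<in> M \<rightarrow>\<^sub>M count_space UNIV"
  using indep unfolding indep_vars_def by (auto dest: bspec[of _ _ "Inl i"])

lemma \<xi>_measurable: "1 \<le> i \<Longrightarrow> 1 \<le> l \<Longrightarrow> \<xi> i l \<in> M \<rightarrow>\<^sub>M count_space UNIV"
  using indep unfolding indep_vars_def by (auto dest: bspec[of _ _ "Inr (i, l)"])

lemma state_measurable: "state D \<xi> \<pi> x i \<in> M \<rightarrow>\<^sub>M count_space UNIV"
  by (rule measurable_state) (auto intro: D_measurable \<xi>_measurable)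

lemma level_measurable: "level \<pi> x i \<in> M \<rightarrow>\<^sub>M count_space UNIV"
  by (rule measurable_compose[OF state_measurable]) simp

lemma borel_measurable_state:
  fixes H :: "int \<Rightarrow> 'b::topological_space"
  shows "(\<lambda>\<omega>. H (state D \<xi> \<pi> x i \<omega>)) \<in> borel_measurable M"
  by (rule measurable_compose[OF state_measurable]) simp

lemma borel_measurable_level_demand:
  fixes H :: "int \<Rightarrow> nat \<Rightarrow> 'b::topological_space"
  assumes "1 \<le> i" shows "(\<lambda>\<omega>. H (level \<pi> x i \<omega>) (D i \<omega>)) \<in> borel_measurable M"
proof (rule measurable_compose_countable[OF _ level_measurable])
  show "(\<lambda>\<omega>. H j (D i \<omega>)) \<in> borel_measurable M" for j
    by (rule measurable_compose[OF D_measurable[OF assms]]) simp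
qed

lemma D_nn_integral:
  assumes "1 \<le> i"
  shows "(\<integral>\<^sup>+\<omega>. f (D i \<omega>) \<partial>M) = (\<integral>\<^sup>+\<omega>. f (D 1 \<omega>) \<partial>M)"
proof -
  have "(\<integral>\<^sup>+\<omega>. f (D i \<omega>) \<partial>M) = (\<integral>\<^sup>+d. f d \<partial>distr M (count_space UNIV) (D i))"
    using assms by (subst nn_integral_distr) (auto intro: D_measurable)
  also have "\<dots> = (\<integral>\<^sup>+\<omega>. f (D 1 \<omega>) \<partial>M)"
    by (subst demand_distr[OF assms], subst nn_integral_distr) (auto intro: D_measurable)
  finally show ?thesis .
qed

lemma expectation_\<xi>:
  assumes "1 \<le> i" "1 \<le> l"
  shows "integrable M (\<lambda>\<omega>. real (\<xi> i l \<omega>))" "expectation (\<lambda>\<omega>. real (\<xi> i l \<omega>)) = p"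
proof -
  have meas: "\<xi> i l \<in> M \<rightarrow>\<^sub>M count_space UNIV"
    using assms by (rule \<xi>_measurable)
  have "finite (set_pmf (map_pmf (of_bool :: bool \<Rightarrow> nat) (bernoulli_pmf p)))"
    by (simp add: finite_subset[OF subset_UNIV])
  then have "integrable (measure_pmf (map_pmf (of_bool :: bool \<Rightarrow> nat) (bernoulli_pmf p))) real"
    by (rule integrable_measure_pmf_finite)
  then have "integrable (distr M (count_space UNIV) (\<xi> i l)) real"
    unfolding patience_distr[OF assms] .
  then show "integrable M (\<lambda>\<omega>. real (\<xi> i l \<omega>))"
    by (subst (asm) integrable_distr_eq[OF meas]) auto
  have "expectation (\<lambda>\<omega>. real (\<xi> i l \<omega>)) = (\<integral>n. real n \<partial>distr M (count_space UNIV) (\<xi> i l))"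
    by (subst integral_distr[OF meas]) auto
  also have "\<dots> = p"
    unfolding patience_distr[OF assms] using p_nonneg p_le_1 by simp
  finally show "expectation (\<lambda>\<omega>. real (\<xi> i l \<omega>)) = p" .
qed

text \<open>The recursion is run on the product space itself, with coordinates in place of demands
  and indicators, which exhibits the state as a measurable function of earlier variables. The set A
  is left open because it is used both with the strict past and with the past enlarged by the
  current demand.\<close>

lemma state_past:
  fixes A :: "(nat + nat \<times> nat) set" and \<pi> x i
  assumes A: "{1..<i} <+> {1..<i} \<times> {1..} \<subseteq> A"
  defines "S \<equiv> state (\<lambda>j g. g (Inl j)) (\<lambda>j l g. g (Inr (j, l))) \<pi> x i"
  shows "S \<in> PiM A (\<lambda>_. count_space UNIV) \<rightarrow>\<^sub>M count_space UNIV"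
    and "state D \<xi> \<pi> x i \<omega> = S (\<lambda>k\<in>A. case_sum D (\<lambda>(i, l). \<xi> i l) k \<omega>)"
proof -
  have *: "Inl j \<in> A" "1 \<le> l \<Longrightarrow> Inr (j, l) \<in> A" if "1 \<le> j" "j < i" for j l
    using that A by auto
  show "S \<in> PiM A (\<lambda>_. count_space UNIV) \<rightarrow>\<^sub>M count_space UNIV"
    unfolding S_def by (rule measurable_state) (auto intro!: measurable_component_singleton *)
  show "state D \<xi> \<pi> x i \<omega> = S (\<lambda>k\<in>A. case_sum D (\<lambda>(i, l). \<xi> i l) k \<omega>)"
    unfolding S_def by (rule state_cong) (auto simp: *)
qed

text \<open>Disjoint index sets of an independent family give independent blocks. The demand is cast
  to int because \<open>indep_var\<close> compares two variables with values in the same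
  type.\<close>

lemma indep_state_demand:
  assumes "1 \<le> i"
  shows "indep_var (count_space UNIV) (state D \<xi> \<pi> x i) (count_space UNIV) (\<lambda>\<omega>. int (D i \<omega>))"
proof -
  define A where "A = ({1..<i} <+> {1..<i} \<times> {1..} :: (nat + nat \<times> nat) set)"
  define B where "B = ({Inl i} :: (nat + nat \<times> nat) set)"
  let ?X = "case_sum D (\<lambda>(i, l). \<xi> i l)"
  let ?S = "state (\<lambda>j g. g (Inl j)) (\<lambda>j l g. g (Inr (j, l))) \<pi> x i"
  have "indep_var (PiM A (\<lambda>_. count_space UNIV)) (\<lambda>\<omega>. \<lambda>k\<in>A. ?X k \<omega>)
      (PiM B (\<lambda>_. count_space UNIV)) (\<lambda>\<omega>. \<lambda>k\<in>B. ?X k \<omega>)"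
    using assms by (intro indep_var_restrict[OF indep]) (auto simp: A_def B_def)
  then have "indep_var (count_space UNIV) (?S \<circ> (\<lambda>\<omega>. \<lambda>k\<in>A. ?X k \<omega>))
      (count_space UNIV) ((\<lambda>g. int (g (Inl i))) \<circ> (\<lambda>\<omega>. \<lambda>k\<in>B. ?X k \<omega>))"
    by (rule indep_var_compose[OF _ state_past(1)])
      (simp_all add: A_def B_def measurable_compose[OF measurable_component_singleton])
  moreover have "?S \<circ> (\<lambda>\<omega>. \<lambda>k\<in>A. ?X k \<omega>) = state D \<xi> \<pi> x i"
    by (subst fun_eq_iff, subst state_past(2)[of i A]) (auto simp: A_def)
  moreover have "(\<lambda>g. int (g (Inl i))) \<circ> (\<lambda>\<omega>. \<lambda>k\<in>B. ?X k \<omega>) = (\<lambda>\<omega>. int (D i \<omega>))"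
    by (auto simp: B_def)
  ultimately show ?thesis
    by metis
qed

lemma indep_level_demand_patience:
  fixes H :: "int \<Rightarrow> nat \<Rightarrow> real"
  assumes "1 \<le> i" "1 \<le> l"
  shows "indep_var borel (\<lambda>\<omega>. H (level \<pi> x i \<omega>) (D i \<omega>)) borel (\<lambda>\<omega>. real (\<xi> i l \<omega>))"
proof -
  \<comment> \<open>The block contains the demand of period i but none of its patience indicators,
    since the factor multiplied by \<open>\<xi> i l\<close> depends on both level and
    demand.\<close>
  define A where "A = ({1..i} <+> {1..<i} \<times> {1..} :: (nat + nat \<times> nat) set)"
  define B where "B = ({Inr (i, l)} :: (nat + nat \<times> nat) set)"
  let ?X = "case_sum D (\<lambda>(i, l). \<xi> i l)"
  let ?S = "state (\<lambda>j g. g (Inl j)) (\<lambda>j l g. g (Inr (j, l))) \<pi> x i"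
  let ?T = "\<lambda>g. H (?S g + int (\<pi> i (?S g))) (g (Inl i))"
  have A: "{1..<i} <+> {1..<i} \<times> {1..} \<subseteq> A"
    by (auto simp: A_def)
  have i_in: "Inl i \<in> A"
    using assms by (auto simp: A_def)
  have comp: "(\<lambda>g. g (Inl i)) \<in> PiM A (\<lambda>_. count_space UNIV) \<rightarrow>\<^sub>M count_space UNIV"
    using i_in by (rule measurable_component_singleton)
  have T: "?T \<in> borel_measurable (PiM A (\<lambda>_. count_space UNIV))"
    by (rule measurable_compose_countable[OF _ state_past(1)[OF A]],
        rule measurable_compose[OF comp]) simp
  have "indep_var (PiM A (\<lambda>_. count_space UNIV)) (\<lambda>\<omega>. \<lambda>k\<in>A. ?X k \<omega>)
      (PiM B (\<lambda>_. count_space UNIV)) (\<lambda>\<omega>. \<lambda>k\<in>B. ?X k \<omega>)"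
    using assms by (intro indep_var_restrict[OF indep]) (auto simp: A_def B_def)
  then have "indep_var borel (?T \<circ> (\<lambda>\<omega>. \<lambda>k\<in>A. ?X k \<omega>))
      borel ((\<lambda>g. real (g (Inr (i, l)))) \<circ> (\<lambda>\<omega>. \<lambda>k\<in>B. ?X k \<omega>))"
    by (rule indep_var_compose[OF _ T])
      (rule measurable_compose[OF measurable_component_singleton], auto simp: B_def)
  moreover have "?T \<circ> (\<lambda>\<omega>. \<lambda>k\<in>A. ?X k \<omega>) = (\<lambda>\<omega>. H (level \<pi> x i \<omega>) (D i \<omega>))"
    using i_in by (simp add: fun_eq_iff state_past(2)[OF A])
  moreover have "(\<lambda>g. real (g (Inr (i, l)))) \<circ> (\<lambda>\<omega>. \<lambda>k\<in>B. ?X k \<omega>) = (\<lambda>\<omega>. real (\<xi> i l \<omega>))"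
    by (auto simp: B_def)
  ultimately show ?thesis
    by metis
qed

text \<open>Wald's identity. It is proved in ennreal, before any finiteness of the backorder is
  known.\<close>

lemma nn_integral_backorder_Suc:
  assumes i: "1 \<le> i"
  shows "(\<integral>\<^sup>+\<omega>. ennreal (real_of_int (neg (state D \<xi> \<pi> x (Suc i) \<omega>))) \<partial>M)
    = ennreal p * (\<integral>\<^sup>+\<omega>. ennreal (real_of_int (pos (int (D i \<omega>) - level \<pi> x i \<omega>))) \<partial>M)"
proof -
  define E where "E l \<omega> = (of_bool (level \<pi> x i \<omega> + int (Suc l) \<le> int (D i \<omega>)) :: real)" for l \<omega>
  have E_meas [measurable]: "E l \<in> borel_measurable M" for l
    unfolding E_def
    by (rule borel_measurable_level_demand[OF i, of "\<lambda>y d. of_bool (y + int (Suc l) \<le> int d)"])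
  have \<xi>_meas [measurable]: "(\<lambda>\<omega>. real (\<xi> i (Suc l) \<omega>)) \<in> borel_measurable M" for l
    using \<xi>_measurable[OF i, of "Suc l"] by simp
  have E_int: "integrable M (E l)" for l
    by (rule integrable_const_bound[of _ 1]) (auto simp: E_def)
  have ind: "indep_var borel (E l) borel (\<lambda>\<omega>. real (\<xi> i (Suc l) \<omega>))" for l
    using indep_level_demand_patience[OF i, of "Suc l" "\<lambda>y d. of_bool (y + int (Suc l) \<le> int d)"]
    by (simp add: E_def[abs_def])
  have E_\<xi>: "(\<integral>\<^sup>+\<omega>. ennreal (E l \<omega> * real (\<xi> i (Suc l) \<omega>)) \<partial>M)
      = ennreal p * (\<integral>\<^sup>+\<omega>. ennreal (E l \<omega>) \<partial>M)" for l
  proof -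
    note X = expectation_\<xi>[OF i, of "Suc l"]
    have "(\<integral>\<^sup>+\<omega>. ennreal (E l \<omega> * real (\<xi> i (Suc l) \<omega>)) \<partial>M)
        = ennreal (expectation (\<lambda>\<omega>. E l \<omega> * real (\<xi> i (Suc l) \<omega>)))"
      using indep_var_integrable[OF ind E_int] X by (intro nn_integral_eq_integral) (auto simp: E_def)
    also have "\<dots> = ennreal (p * expectation (E l))"
      using indep_var_lebesgue_integral[OF ind E_int] X by (simp add: mult.commute)
    also have "\<dots> = ennreal p * (\<integral>\<^sup>+\<omega>. ennreal (E l \<omega>) \<partial>M)"
      using E_int p_nonneg
      by (subst nn_integral_eq_integral) (auto simp: E_def ennreal_mult intro!: integral_nonneg_AE)
    finally show ?thesis .
  qed
  have "(\<integral>\<^sup>+\<omega>. ennreal (real_of_int (neg (state D \<xi> \<pi> x (Suc i) \<omega>))) \<partial>M)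
      = (\<integral>\<^sup>+\<omega>. (\<Sum>l. ennreal (E l \<omega> * real (\<xi> i (Suc l) \<omega>))) \<partial>M)"
    using i by (simp add: neg_next_state_eq_suminf E_def del: of_int_max)
  also have "\<dots> = (\<Sum>l. ennreal p * (\<integral>\<^sup>+\<omega>. ennreal (E l \<omega>) \<partial>M))"
    by (subst nn_integral_suminf) (auto simp: E_\<xi>)
  also have "\<dots> = ennreal p * (\<integral>\<^sup>+\<omega>. (\<Sum>l. ennreal (E l \<omega>)) \<partial>M)"
    by (subst nn_integral_suminf) auto
  finally show ?thesis
    by (simp add: pos_eq_suminf E_def del: of_int_max)
qed

text \<open>Conditioning on the level: by independence and Fubini the current demand can be
  integrated out first, and by equality of laws it may be replaced by the first one.\<close>

lemma nn_integral_level_demand: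
  fixes H :: "int \<Rightarrow> nat \<Rightarrow> ennreal"
  assumes i: "1 \<le> i"
  shows "(\<integral>\<^sup>+\<omega>. H (level \<pi> x i \<omega>) (D i \<omega>) \<partial>M) = (\<integral>\<^sup>+\<omega>. (\<integral>\<^sup>+\<omega>'. H (level \<pi> x i \<omega>) (D 1 \<omega>') \<partial>M) \<partial>M)"
proof -
  let ?C = "count_space UNIV :: int measure"
  let ?P = "distr M ?C (state D \<xi> \<pi> x i)" and ?Q = "distr M ?C (\<lambda>\<omega>. int (D i \<omega>))"
  let ?H = "\<lambda>(n, d). H (n + int (\<pi> i n)) (nat d)"
  have rv: "state D \<xi> \<pi> x i \<in> M \<rightarrow>\<^sub>M ?C" "(\<lambda>\<omega>. int (D i \<omega>)) \<in> M \<rightarrow>\<^sub>M ?C"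
    using state_measurable measurable_compose[OF D_measurable[OF i], of int ?C] by auto
  interpret Q: prob_space ?Q by (rule prob_space_distr[OF rv(2)])
  have meas: "?H \<in> borel_measurable (?C \<Otimes>\<^sub>M ?C)"
    by (simp add: pair_measure_countable)
  have "(\<integral>\<^sup>+\<omega>. H (level \<pi> x i \<omega>) (D i \<omega>) \<partial>M)
      = (\<integral>\<^sup>+z. ?H z \<partial>distr M (?C \<Otimes>\<^sub>M ?C) (\<lambda>\<omega>. (state D \<xi> \<pi> x i \<omega>, int (D i \<omega>))))"
    using meas by (subst nn_integral_distr) (auto intro!: measurable_Pair rv)
  also have "\<dots> = (\<integral>\<^sup>+z. ?H z \<partial>(?P \<Otimes>\<^sub>M ?Q))"
    using indep_state_demand[OF i] by (simp add: indep_var_distribution_eq)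
  also have "\<dots> = (\<integral>\<^sup>+n. \<integral>\<^sup>+d. ?H (n, d) \<partial>?Q \<partial>?P)"
    by (rule Q.nn_integral_fst[symmetric]) (use meas in \<open>simp cong: measurable_cong_sets\<close>)
  also have "\<dots> = (\<integral>\<^sup>+\<omega>. (\<integral>\<^sup>+\<omega>'. H (level \<pi> x i \<omega>) (D i \<omega>') \<partial>M) \<partial>M)"
    by (subst nn_integral_distr[OF rv(1)], simp, subst nn_integral_distr[OF rv(2)]) auto
  finally show ?thesis
    by (simp add: D_nn_integral[OF i])
qed

section \<open>Expected shortage and growth of the expected backorder\<close>

lemma D1_measurable [measurable]:
  "D 1 \<in> M \<rightarrow>\<^sub>M count_space UNIV" "D (Suc 0) \<in> M \<rightarrow>\<^sub>M count_space UNIV"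
  using D_measurable[of 1] by simp_all

lemma integrable_min_demand: "integrable M (\<lambda>\<omega>. real_of_int (min y (int (D 1 \<omega>))))"
  by (rule Bochner_Integration.integrable_bound
      [OF Bochner_Integration.integrable_add[OF demand_mean integrable_const[of "\<bar>real_of_int y\<bar>"]]]) auto

lemma integrable_shortage: "integrable M (\<lambda>\<omega>. real_of_int (pos (int (D 1 \<omega>) - y)))"
  and expectation_shortage:
    "expectation (\<lambda>\<omega>. real_of_int (pos (int (D 1 \<omega>) - y))) = mean_demand - mean_min_demand y"
proof -
  have eq: "real_of_int (pos (int (D 1 \<omega>) - y)) = real (D 1 \<omega>) - real_of_int (min y (int (D 1 \<omega>)))" for \<omega>
    by (simp add: max_def min_def)
  show "integrable M (\<lambda>\<omega>. real_of_int (pos (int (D 1 \<omega>) - y)))"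
    unfolding eq using demand_mean integrable_min_demand by (rule Bochner_Integration.integrable_diff)
  show "expectation (\<lambda>\<omega>. real_of_int (pos (int (D 1 \<omega>) - y))) = mean_demand - mean_min_demand y"
    unfolding eq mean_min_demand_def
    using demand_mean integrable_min_demand by (rule Bochner_Integration.integral_diff)
qed

lemma mean_min_demand_le_mean_demand: "mean_min_demand y \<le> mean_demand"
  unfolding mean_min_demand_def by (rule integral_mono[OF integrable_min_demand demand_mean]) simp

lemma nn_integral_shortage:
  "(\<integral>\<^sup>+\<omega>. ennreal (real_of_int (pos (int (D 1 \<omega>) - y))) \<partial>M) = ennreal (mean_demand - mean_min_demand y)"
  by (subst nn_integral_eq_integral[OF integrable_shortage])
    (simp_all add: expectation_shortage del: of_int_max One_nat_def)

lemma nn_integral_backorder_Suc_level: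
  assumes "1 \<le> i"
  shows "(\<integral>\<^sup>+\<omega>. ennreal (real_of_int (neg (state D \<xi> \<pi> x (Suc i) \<omega>))) \<partial>M)
    = (\<integral>\<^sup>+\<omega>. ennreal (p * (mean_demand - mean_min_demand (level \<pi> x i \<omega>))) \<partial>M)"
proof -
  have [measurable]: "(\<lambda>\<omega>. mean_min_demand (level \<pi> x i \<omega>)) \<in> borel_measurable M"
    by (rule borel_measurable_state)
  show ?thesis
    unfolding nn_integral_backorder_Suc[OF assms]
      nn_integral_level_demand[OF assms, of "\<lambda>y d. ennreal (real_of_int (pos (int d - y)))"]
      nn_integral_shortage
    using p_nonneg mean_min_demand_le_mean_demand by (simp add: ennreal_mult flip: nn_integral_cmult)
qed

text \<open>Since orders are nonnegative, the shortage of a period is at most the present backorder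
  plus the demand, and by p \<le> 1 at most that much is backordered in the mean. Linear growth,
  uniform in the policy, is what discounting overcomes.\<close>

lemma nn_integral_backorder_le:
  "(\<integral>\<^sup>+\<omega>. ennreal (real_of_int (neg (state D \<xi> \<pi> x (Suc n) \<omega>))) \<partial>M)
    \<le> ennreal (real_of_int (neg x) + real n * mean_demand)"
proof (induction n)
  case 0
  show ?case by (simp add: emeasure_space_1 del: of_int_max)
next
  case (Suc n)
  have [measurable]: "D (Suc n) \<in> M \<rightarrow>\<^sub>M count_space UNIV"
    by (rule D_measurable) simp
  have [measurable]: "state D \<xi> \<pi> x (Suc n) \<in> M \<rightarrow>\<^sub>M count_space UNIV"
    by (rule state_measurable)
  have D: "(\<integral>\<^sup>+\<omega>. ennreal (real (D (Suc n) \<omega>)) \<partial>M) = ennreal mean_demand"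
    by (subst D_nn_integral) (auto intro!: nn_integral_eq_integral demand_mean simp del: One_nat_def)
  let ?N = "state D \<xi> \<pi> x (Suc n)" and ?Y = "level \<pi> x (Suc n)"
  have "(\<integral>\<^sup>+\<omega>. ennreal (real_of_int (neg (state D \<xi> \<pi> x (Suc (Suc n)) \<omega>))) \<partial>M)
      \<le> (\<integral>\<^sup>+\<omega>. ennreal (real_of_int (pos (int (D (Suc n) \<omega>) - ?Y \<omega>))) \<partial>M)"
    using mult_right_mono[of "ennreal p" 1] p_le_1
    by (subst nn_integral_backorder_Suc) (auto simp: ennreal_le_1)
  also have "\<dots> \<le> (\<integral>\<^sup>+\<omega>. ennreal (real_of_int (neg (?N \<omega>))) + ennreal (real (D (Suc n) \<omega>)) \<partial>M)"
    by (intro nn_integral_mono) (auto simp flip: ennreal_plus simp del: state.simps intro!: ennreal_leI)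
  also have "\<dots> = (\<integral>\<^sup>+\<omega>. ennreal (real_of_int (neg (?N \<omega>))) \<partial>M) + ennreal mean_demand"
    using D by (subst nn_integral_add) (auto simp del: state.simps)
  also have "\<dots> \<le> ennreal (real_of_int (neg x) + real n * mean_demand) + ennreal mean_demand"
    using Suc by (rule add_right_mono)
  also have "\<dots> = ennreal (real_of_int (neg x) + real (Suc n) * mean_demand)"
    by (simp flip: ennreal_plus add: algebra_simps)
  finally show ?case .
qed

lemma integrable_backorder:
  "integrable M (\<lambda>\<omega>. real_of_int (neg (state D \<xi> \<pi> x (Suc n) \<omega>)))"
  using nn_integral_backorder_le[of \<pi> x n]
  by (intro integrableI_nonneg borel_measurable_state) (auto simp del: state.simps intro: le_less_trans)

lemma mean_backorder_le:
  "mean_backorder \<pi> x (Suc n) \<le> real_of_int (neg x) + real n * mean_demand"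
proof -
  have "ennreal (mean_backorder \<pi> x (Suc n)) \<le> ennreal (real_of_int (neg x) + real n * mean_demand)"
    using nn_integral_backorder_le[of \<pi> x n] integrable_backorder unfolding mean_backorder_def
    by (subst (asm) nn_integral_eq_integral) (auto simp del: state.simps)
  then show ?thesis
    by (subst (asm) ennreal_le_iff) (auto intro!: add_nonneg_nonneg mult_nonneg_nonneg)
qed

lemma mean_backorder_nonneg: "0 \<le> mean_backorder \<pi> x i"
  unfolding mean_backorder_def by (rule integral_nonneg_AE) simp

text \<open>Integrability is read off from the ennreal identity, whose backorder side is already
  known to be finite.\<close>

lemma integrable_level_shortage:
    "1 \<le> i \<Longrightarrow> integrable M (\<lambda>\<omega>. p * (mean_demand - mean_min_demand (level \<pi> x i \<omega>)))"
  and mean_backorder_Suc: "1 \<le> i \<Longrightarrow>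
    mean_backorder \<pi> x (Suc i) = expectation (\<lambda>\<omega>. p * (mean_demand - mean_min_demand (level \<pi> x i \<omega>)))"
proof -
  assume i: "1 \<le> i"
  have nonneg: "0 \<le> p * (mean_demand - mean_min_demand y)" for y
    using p_nonneg mean_min_demand_le_mean_demand by simp
  have nn: "(\<integral>\<^sup>+\<omega>. ennreal (p * (mean_demand - mean_min_demand (level \<pi> x i \<omega>))) \<partial>M)
      = ennreal (mean_backorder \<pi> x (Suc i))"
    unfolding nn_integral_backorder_Suc_level[OF i, symmetric] mean_backorder_def
    by (rule nn_integral_eq_integral[OF integrable_backorder]) simp
  show "integrable M (\<lambda>\<omega>. p * (mean_demand - mean_min_demand (level \<pi> x i \<omega>)))"
    by (rule integrableI_nonneg) (use nn nonneg in \<open>auto intro: borel_measurable_state\<close>)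
  then show "mean_backorder \<pi> x (Suc i) = expectation (\<lambda>\<omega>. p * (mean_demand - mean_min_demand (level \<pi> x i \<omega>)))"
    using nn nonneg mean_backorder_nonneg
    by (subst (asm) nn_integral_eq_integral)
      (simp_all del: Bochner_Integration.integral_mult_right_zero One_nat_def)
qed

section \<open>Concavity of the myopic profit\<close>

abbreviation myopic_profit :: "int \<Rightarrow> real" where
  "myopic_profit \<equiv> one_period_profit_o M D \<xi> \<alpha> r h"

lemma one_period_profit_eq:
  "one_period_profit M D r h x Q
    = r * real_of_int (neg x) + (r + h) * mean_min_demand (x + int Q) - h * real_of_int (x + int Q)"
proof -
  let ?y = "x + int Q"
  have "r * real_of_int (min (int Q) (neg x) + min (pos (int Q + x)) (int d))
         - h * real_of_int (pos (?y - int d))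
      = (r * real_of_int (neg x) - h * real_of_int ?y) + (r + h) * real_of_int (min ?y (int d))" for d
  proof -
    \<comment> \<open>If the level y is negative, all Q = x^- + y units go to the backlog and min y
      d = y; otherwise the whole backlog x^- is cleared and min y d is sold to new demand.\<close>
    have sales: "min (int Q) (neg x) + min (pos (int Q + x)) (int d) = neg x + min ?y (int d)"
      and hold: "pos (?y - int d) = ?y - min ?y (int d)"
      by linarith+
    show ?thesis
      unfolding sales hold by (simp add: algebra_simps)
  qed
  then have "one_period_profit M D r h x Q = expectation (\<lambda>\<omega>.
      (r * real_of_int (neg x) - h * real_of_int ?y) + (r + h) * real_of_int (min ?y (int (D 1 \<omega>))))"
    unfolding one_period_profit_def by presburger
  also have "\<dots> = (r * real_of_int (neg x) - h * real_of_int ?y) + (r + h) * mean_min_demand ?y"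
    unfolding mean_min_demand_def using integrable_min_demand[of ?y]
    by (subst Bochner_Integration.integral_add) (simp_all add: prob_space del: of_int_min One_nat_def)
  finally show ?thesis
    by simp
qed

lemma myopic_profit_eq:
  "myopic_profit y = (r + h - \<alpha> * r * p) * mean_min_demand y - h * real_of_int y + \<alpha> * r * p * mean_demand"
proof -
  let ?B = "\<lambda>\<omega>. real_of_int (neg (next_state y (D 1 \<omega>) (\<lambda>l. \<xi> 1 l \<omega>)))"
  \<comment> \<open>The transition out of y is period 2 of the policy that never orders, started at
    y, so the results on states give its expected backorder.\<close>
  have state2: "state D \<xi> (\<lambda>_ _. 0) y (Suc 1) \<omega> = next_state y (D 1 \<omega>) (\<lambda>l. \<xi> 1 l \<omega>)"
    and level1: "level (\<lambda>_ _. 0) y 1 \<omega> = y" for \<omega>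
    by simp_all
  have B_int: "integrable M ?B"
    using integrable_backorder[of "\<lambda>_ _. 0" y 1] unfolding state2 .
  have B_exp: "expectation ?B = p * (mean_demand - mean_min_demand y)"
    using mean_backorder_Suc[of 1 "\<lambda>_ _. 0" y]
    unfolding mean_backorder_def state2 level1 by (simp add: prob_space)
  have "r * real_of_int (min (pos y) (int d)) - h * real_of_int (pos (y - int d))
      = (r * real_of_int (neg y) - h * real_of_int y) + (r + h) * real_of_int (min y (int d))" for d
  proof -
    have sales: "min (pos y) (int d) = neg y + min y (int d)"
      and hold: "pos (y - int d) = y - min y (int d)"
      by linarith+
    show ?thesis
      unfolding sales hold by (simp add: algebra_simps)
  qed
  then have "myopic_profit y = - r * real_of_int (neg y) + expectation (\<lambda>\<omega>.
      (r * real_of_int (neg y) - h * real_of_int y) + (r + h) * real_of_int (min y (int (D 1 \<omega>)))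
       + \<alpha> * r * ?B \<omega>)"
    unfolding one_period_profit_o_def by presburger
  also have "\<dots> = - r * real_of_int (neg y)
      + ((r * real_of_int (neg y) - h * real_of_int y) + (r + h) * mean_min_demand y + \<alpha> * r * expectation ?B)"
    unfolding mean_min_demand_def using integrable_min_demand[of y] B_int
    by (simp add: prob_space del: of_int_min of_int_max One_nat_def)
  finally show ?thesis
    unfolding B_exp by (simp add: algebra_simps)
qed

text \<open>One link of the telescoping: the subtracted term is \<alpha> r times the expected
  backorder of the next period given the present level.\<close>

lemma one_period_profit_myopic:
  "one_period_profit M D r h x Q = r * real_of_int (neg x) + myopic_profit (x + int Q)
     - \<alpha> * r * (p * (mean_demand - mean_min_demand (x + int Q)))"
  unfolding one_period_profit_eq myopic_profit_eq by (simp add: algebra_simps)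

lemma mean_min_demand_le: "mean_min_demand y \<le> real_of_int y"
proof -
  have "mean_min_demand y \<le> expectation (\<lambda>\<omega>. real_of_int y)"
    unfolding mean_min_demand_def by (rule integral_mono[OF integrable_min_demand]) auto
  then show ?thesis by (simp add: prob_space)
qed

lemma mean_min_demand_nonpos: "y \<le> 0 \<Longrightarrow> mean_min_demand y = real_of_int y"
  unfolding mean_min_demand_def by (simp add: prob_space min_absorb1)

text \<open>Concavity in cross-multiplied form, which stays in the integers before taking
  expectations and covers x = z.\<close>

lemma mean_min_demand_concave:
  assumes "x \<le> y" "y \<le> z"
  shows "real_of_int (z - y) * mean_min_demand x + real_of_int (y - x) * mean_min_demand z
    \<le> real_of_int (z - x) * mean_min_demand y"
proof -
  \<comment> \<open>min(., d) lies below both the identity and the constant d; the one that is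
    attained at y gives the bound.\<close>
  have *: "(z - y) * min x d + (y - x) * min z d \<le> (z - x) * min y d" for d :: int
  proof (cases "y \<le> d")
    case True
    have "(z - y) * min x d + (y - x) * min z d \<le> (z - y) * x + (y - x) * z"
      using assms by (intro add_mono mult_left_mono) auto
    also have "\<dots> = (z - x) * y"
      by (simp add: algebra_simps)
    finally show ?thesis using True by simp
  next
    case False
    have "(z - y) * min x d + (y - x) * min z d \<le> (z - y) * d + (y - x) * d"
      using assms by (intro add_mono mult_left_mono) auto
    also have "\<dots> = (z - x) * d"
      by (simp add: algebra_simps)
    finally show ?thesis using False by simp
  qed
  have "real_of_int (z - y) * mean_min_demand x + real_of_int (y - x) * mean_min_demand z
      = expectation (\<lambda>\<omega>. real_of_int (z - y) * real_of_int (min x (int (D 1 \<omega>)))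
          + real_of_int (y - x) * real_of_int (min z (int (D 1 \<omega>))))"
    unfolding mean_min_demand_def using integrable_min_demand[of x] integrable_min_demand[of z]
    by (simp del: of_int_min One_nat_def of_int_diff)
  also have "\<dots> \<le> expectation (\<lambda>\<omega>. real_of_int (z - x) * real_of_int (min y (int (D 1 \<omega>))))"
    using integrable_min_demand
    by (intro integral_mono Bochner_Integration.integrable_add integrable_mult_right)
      (use * in \<open>simp_all only: of_int_le_iff flip: of_int_mult of_int_add\<close>)
  also have "\<dots> = real_of_int (z - x) * mean_min_demand y"
    unfolding mean_min_demand_def using integrable_min_demand[of y]
    by (simp del: of_int_min One_nat_def of_int_diff)
  finally show ?thesis .
qed

text \<open>This is \<alpha> p < 1: delaying a sale loses value strictly. It makes the myopic profit
  strictly increasing on negative levels.\<close>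

lemma holding_cost_less_coefficient: "h < r + h - \<alpha> * r * p"
proof -
  have "\<alpha> * p < 1"
    using \<alpha>_pos \<alpha>_less_1 p_le_1 mult_left_mono[of p 1 \<alpha>] by linarith
  then have "r * (\<alpha> * p) < r"
    using r_pos by simp
  then show ?thesis
    by (simp add: algebra_simps)
qed

lemma quasi_concave_myopic_profit: "quasi_concave myopic_profit"
  unfolding quasi_concave_def
proof (intro allI impI)
  fix x y z :: int
  assume "x \<le> y \<and> y \<le> z"
  then have xyz: "x \<le> y" "y \<le> z" by auto
  let ?f = myopic_profit and ?m = "min (myopic_profit x) (myopic_profit z)"
  \<comment> \<open>The affine part of \<open>myopic_profit_eq\<close> cancels in the three-point
    combination, so only the concavity of \<open>mean_min_demand\<close> remains.\<close>
  have eq: "(z' - x') * ((r + h - \<alpha> * r * p) * a - h * y' + \<alpha> * r * p * mean_demand)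
     - (z' - y') * ((r + h - \<alpha> * r * p) * b - h * x' + \<alpha> * r * p * mean_demand)
     - (y' - x') * ((r + h - \<alpha> * r * p) * c - h * z' + \<alpha> * r * p * mean_demand)
     = (r + h - \<alpha> * r * p) * ((z' - x') * a - (z' - y') * b - (y' - x') * c)"
    for x' y' z' a b c :: real
    by (simp add: algebra_simps)
  have "0 \<le> (r + h - \<alpha> * r * p) * (real_of_int (z - x) * mean_min_demand y
      - real_of_int (z - y) * mean_min_demand x - real_of_int (y - x) * mean_min_demand z)"
    using mean_min_demand_concave[OF xyz] holding_cost_less_coefficient h_pos by (intro mult_nonneg_nonneg) auto
  then have "real_of_int (z - y) * ?f x + real_of_int (y - x) * ?f z \<le> real_of_int (z - x) * ?f y"
    using eq[of "real_of_int z" "real_of_int x" "mean_min_demand y" "real_of_int y"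
        "mean_min_demand x" "mean_min_demand z"]
    unfolding myopic_profit_eq of_int_diff by linarith
  moreover have "real_of_int (z - y) * ?m + real_of_int (y - x) * ?m
      \<le> real_of_int (z - y) * ?f x + real_of_int (y - x) * ?f z"
    using xyz by (intro add_mono mult_left_mono) auto
  moreover have "real_of_int (z - y) * ?m + real_of_int (y - x) * ?m = real_of_int (z - x) * ?m"
    by (simp add: algebra_simps)
  ultimately have "real_of_int (z - x) * ?m \<le> real_of_int (z - x) * ?f y"
    by linarith
  then show "?m \<le> ?f y"
    using xyz by (cases "x = z") (auto simp: mult_le_cancel_left)
qed

section \<open>Sign and existence of a maximizer of the myopic profit\<close>

lemma myopic_profit_0: "myopic_profit 0 = \<alpha> * r * p * mean_demand"
  by (simp add: myopic_profit_eq mean_min_demand_nonpos)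

lemma myopic_profit_0_nonneg: "0 \<le> myopic_profit 0"
  unfolding myopic_profit_0 using \<alpha>_pos r_pos p_nonneg by (intro mult_nonneg_nonneg) auto

lemma myopic_profit_negative: "y < 0 \<Longrightarrow> myopic_profit y < myopic_profit 0"
proof -
  assume "y < 0"
  then have "(r + h - \<alpha> * r * p - h) * real_of_int y < 0"
    using holding_cost_less_coefficient by (intro mult_pos_neg) auto
  then show ?thesis
    unfolding myopic_profit_0 using \<open>y < 0\<close>
    by (simp add: myopic_profit_eq mean_min_demand_nonpos algebra_simps)
qed

lemma myopic_profit_large:
  assumes "(r + h - \<alpha> * r * p) * mean_demand \<le> h * real_of_int y"
  shows "myopic_profit y \<le> myopic_profit 0"
proof -
  have "(r + h - \<alpha> * r * p) * mean_min_demand y \<le> (r + h - \<alpha> * r * p) * mean_demand"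
    using holding_cost_less_coefficient h_pos mean_min_demand_le_mean_demand by (intro mult_left_mono) auto
  then show ?thesis
    unfolding myopic_profit_0 using assms unfolding myopic_profit_eq by linarith
qed

lemma myopic_profit_has_max: "\<exists>s. \<forall>y. myopic_profit y \<le> myopic_profit s"
proof -
  \<comment> \<open>Beyond K the holding cost h y outweighs the greatest possible gain, and below 0
    the profit is under its value at 0, so a maximum over a finite set is global.
    \<open>insert 0\<close> supplies 0 without a proof of 0 \<le> K.\<close>
  define K where "K = \<lceil>(r + h - \<alpha> * r * p) * mean_demand / h\<rceil>"
  define S where "S = insert 0 {0..K}"
  have fin: "finite (myopic_profit ` S)" "myopic_profit ` S \<noteq> {}"
    by (auto simp: S_def)
  obtain s where s: "s \<in> S" "Max (myopic_profit ` S) = myopic_profit s"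
    using Max_in[OF fin] by auto
  have in_S: "myopic_profit y \<le> myopic_profit s" if "y \<in> S" for y
    using Max_ge[OF fin(1), of "myopic_profit y"] that s by auto
  have "myopic_profit y \<le> myopic_profit s" for y
  proof (cases "y \<in> S")
    case False
    then have "y < 0 \<or> K \<le> y"
      by (auto simp: S_def)
    moreover have "(r + h - \<alpha> * r * p) * mean_demand \<le> h * real_of_int y" if "K \<le> y"
    proof -
      have "(r + h - \<alpha> * r * p) * mean_demand / h \<le> real_of_int y"
        using that unfolding K_def by (simp add: ceiling_le_iff)
      then show ?thesis
        using h_pos by (simp add: pos_divide_le_eq mult.commute)
    qed
    ultimately have "myopic_profit y \<le> myopic_profit 0"
      using myopic_profit_negative[of y] myopic_profit_large[of y] by fastforce
    then show ?thesis
      using in_S[of 0] by (simp add: S_def)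
  qed (rule in_S)
  then show ?thesis by blast
qed

section \<open>Telescoping the discounted profit\<close>

abbreviation profit :: "(nat \<Rightarrow> int \<Rightarrow> nat) \<Rightarrow> int \<Rightarrow> nat \<Rightarrow> 'a \<Rightarrow> real" where
  "profit \<pi> x i \<omega> \<equiv>
     one_period_profit M D r h (state D \<xi> \<pi> x i \<omega>) (\<pi> i (state D \<xi> \<pi> x i \<omega>))"

lemma profit_measurable [measurable]: "profit \<pi> x i \<in> borel_measurable M"
  by (rule borel_measurable_state)

lemma discounted_profit_eq:
  "discounted_profit M D \<xi> \<alpha> r h \<pi> x
    = enn2ereal (\<integral>\<^sup>+\<omega>. (\<Sum>i. ennreal (\<alpha> ^ i * profit \<pi> x (Suc i) \<omega>)) \<partial>M)
      - enn2ereal (\<integral>\<^sup>+\<omega>. (\<Sum>i. ennreal (- (\<alpha> ^ i * profit \<pi> x (Suc i) \<omega>))) \<partial>M)"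
  unfolding discounted_profit_def Let_def by (simp del: state.simps)

text \<open>Backorder and expected shortage are integrable under every policy, but the holding cost
  may fail to be; hence integrability of the profit is assumed and passed on to the myopic
  profit.\<close>

lemma expectation_profit:
  assumes i: "1 \<le> i" and g: "integrable M (profit \<pi> x i)"
  shows "integrable M (\<lambda>\<omega>. myopic_profit (level \<pi> x i \<omega>))"
    and "expectation (profit \<pi> x i) = r * mean_backorder \<pi> x i - \<alpha> * r * mean_backorder \<pi> x (Suc i)
      + expectation (\<lambda>\<omega>. myopic_profit (level \<pi> x i \<omega>))"
proof -
  let ?b = "\<lambda>\<omega>. real_of_int (neg (state D \<xi> \<pi> x i \<omega>))"
  let ?c = "\<lambda>\<omega>. p * (mean_demand - mean_min_demand (level \<pi> x i \<omega>))"
  have b: "integrable M ?b" and c: "integrable M ?c"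
    using integrable_backorder[of \<pi> x "i - 1"] integrable_level_shortage[OF i] i by simp_all
  have eq: "myopic_profit (level \<pi> x i \<omega>) = profit \<pi> x i \<omega> - r * ?b \<omega> + \<alpha> * r * ?c \<omega>" for \<omega>
    unfolding one_period_profit_myopic by simp
  have linear: "integrable M (\<lambda>\<omega>. f \<omega> - a * f' \<omega> + a' * f'' \<omega>)"
      "expectation (\<lambda>\<omega>. f \<omega> - a * f' \<omega> + a' * f'' \<omega>)
        = expectation f - a * expectation f' + a' * expectation f''"
    if "integrable M f" "integrable M f'" "integrable M f''" for f f' f'' and a a' :: real
    using that by simp_all
  show "integrable M (\<lambda>\<omega>. myopic_profit (level \<pi> x i \<omega>))"
    unfolding eq using linear(1)[OF g b c] .
  have "expectation (\<lambda>\<omega>. myopic_profit (level \<pi> x i \<omega>))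
      = expectation (profit \<pi> x i) - r * expectation ?b + \<alpha> * r * expectation ?c"
    unfolding eq using linear(2)[OF g b c] .
  then show "expectation (profit \<pi> x i) = r * mean_backorder \<pi> x i - \<alpha> * r * mean_backorder \<pi> x (Suc i)
      + expectation (\<lambda>\<omega>. myopic_profit (level \<pi> x i \<omega>))"
    unfolding mean_backorder_Suc[OF i] unfolding mean_backorder_def by linarith
qed

text \<open>The remainder is kept explicit: the upper bound drops it by its sign, the lower bound
  sends it to 0.\<close>

lemma sum_expected_profit:
  assumes "\<And>i. integrable M (profit \<pi> x (Suc i))"
  shows "(\<Sum>i<n. \<alpha> ^ i * expectation (profit \<pi> x (Suc i)))
    = r * real_of_int (neg x) - \<alpha> ^ n * (r * mean_backorder \<pi> x (Suc n))
      + (\<Sum>i<n. \<alpha> ^ i * expectation (\<lambda>\<omega>. myopic_profit (level \<pi> x (Suc i) \<omega>)))"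
proof (induction n)
  case 0
  show ?case by (simp add: mean_backorder_def prob_space)
next
  case (Suc n)
  have Suc_n: "1 \<le> Suc n" by simp
  from Suc show ?case
    unfolding sum.lessThan_Suc expectation_profit(2)[OF Suc_n assms]
    by (simp add: algebra_simps del: state.simps)
qed

lemma discounted_profit_le:
  assumes max: "\<And>y. myopic_profit y \<le> L"
  shows "discounted_profit M D \<xi> \<alpha> r h \<pi> x \<le> ereal (r * real_of_int (neg x) + L / (1 - \<alpha>))"
proof -
  have L: "0 \<le> L"
    using max[of 0] myopic_profit_0_nonneg by linarith
  let ?G = "\<lambda>i \<omega>. \<alpha> ^ i * profit \<pi> x (Suc i) \<omega>"
  have G_meas: "?G i \<in> borel_measurable M" for i
    by measurable
  \<comment> \<open>A period earns at most r N^- + L; inserting the linear bound on the expected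
    backorder gives this summable majorant.\<close>
  let ?a = "\<lambda>n. \<alpha> ^ n * ((r * real_of_int (neg x) + L) + real n * (r * mean_demand))"
  have a_nonneg: "0 \<le> ?a n" for n
    using \<alpha>_pos r_pos L by (intro mult_nonneg_nonneg add_nonneg_nonneg) auto
  have le: "(\<integral>\<^sup>+\<omega>. ennreal (?G n \<omega>) \<partial>M) \<le> ennreal (?a n)" for n
  proof -
    let ?b = "\<lambda>\<omega>. real_of_int (neg (state D \<xi> \<pi> x (Suc n) \<omega>))"
    have "profit \<pi> x (Suc n) \<omega> \<le> r * ?b \<omega> + L" for \<omega>
    proof -
      have "0 \<le> \<alpha> * r * (p * (mean_demand - mean_min_demand y))" for y
        using \<alpha>_pos r_pos p_nonneg mean_min_demand_le_mean_demand[of y] by (intro mult_nonneg_nonneg) auto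
      then show ?thesis
        unfolding one_period_profit_myopic using max by (smt (verit))
    qed
    then have "?G n \<omega> \<le> \<alpha> ^ n * (r * ?b \<omega> + L)" for \<omega>
      using \<alpha>_pos by (intro mult_left_mono) auto
    then have "(\<integral>\<^sup>+\<omega>. ennreal (?G n \<omega>) \<partial>M) \<le> (\<integral>\<^sup>+\<omega>. ennreal (\<alpha> ^ n * (r * ?b \<omega> + L)) \<partial>M)"
      by (intro nn_integral_mono ennreal_leI)
    also have "\<dots> = ennreal (expectation (\<lambda>\<omega>. \<alpha> ^ n * (r * ?b \<omega> + L)))"
      using integrable_backorder \<alpha>_pos r_pos L by (intro nn_integral_eq_integral) (auto simp del: state.simps)
    also have "expectation (\<lambda>\<omega>. \<alpha> ^ n * (r * ?b \<omega> + L)) = \<alpha> ^ n * (r * mean_backorder \<pi> x (Suc n) + L)"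
      using integrable_backorder[of \<pi> x n] unfolding mean_backorder_def
      by (simp del: state.simps of_int_max add: prob_space)
    also have "\<dots> \<le> ?a n"
      using mult_left_mono[OF mean_backorder_le[of \<pi> x n], of r] r_pos \<alpha>_pos
      by (intro mult_left_mono) (auto simp: algebra_simps)
    finally show ?thesis
      by (simp add: ennreal_leI del: state.simps)
  qed
  have "(\<integral>\<^sup>+\<omega>. (\<Sum>i. ennreal (?G i \<omega>)) \<partial>M) = (\<Sum>i. \<integral>\<^sup>+\<omega>. ennreal (?G i \<omega>) \<partial>M)"
    by (intro nn_integral_suminf measurable_compose[OF G_meas measurable_ennreal])
  also have "\<dots> \<le> (\<Sum>i. ennreal (?a i))"
    using le by (intro suminf_le) auto
  also have "\<dots> < \<infinity>"
    using ennreal_suminf_neq_top[OF summable_affine_discount a_nonneg] \<alpha>_pos \<alpha>_less_1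
    by (auto simp: less_top)
  finally have A: "(\<integral>\<^sup>+\<omega>. (\<Sum>i. ennreal (?G i \<omega>)) \<partial>M) < \<infinity>" .
  show ?thesis
  proof (cases "(\<integral>\<^sup>+\<omega>. (\<Sum>i. ennreal (- ?G i \<omega>)) \<partial>M) < \<infinity>")
    case True
    obtain v where v: "\<And>i. integrable M (?G i)" "(\<lambda>i. expectation (?G i)) sums v"
        "discounted_profit M D \<xi> \<alpha> r h \<pi> x = ereal v"
      by (rule expected_series_diff[OF G_meas A True, folded discounted_profit_eq]) (rule that)
    have int: "integrable M (profit \<pi> x (Suc i))" for i
      using v(1)[of i] \<alpha>_pos by (simp del: state.simps)
    have "(\<Sum>i<n. expectation (?G i)) \<le> r * real_of_int (neg x) + L / (1 - \<alpha>)" for n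
    proof -
      have "expectation (\<lambda>\<omega>. myopic_profit (level \<pi> x (Suc i) \<omega>)) \<le> L" for i
        using integral_mono[OF expectation_profit(1)[OF _ int] integrable_const max, of i]
        by (simp add: prob_space del: state.simps)
      then have "(\<Sum>i<n. \<alpha> ^ i * expectation (\<lambda>\<omega>. myopic_profit (level \<pi> x (Suc i) \<omega>)))
          \<le> (\<Sum>i<n. \<alpha> ^ i * L)"
        using \<alpha>_pos by (intro sum_mono mult_left_mono) auto
      \<comment> \<open>Here L \<ge> 0 is used, to pass from the partial sum to the series.\<close>
      also have "\<dots> \<le> (\<Sum>i. \<alpha> ^ i * L)"
        using \<alpha>_pos \<alpha>_less_1 L by (intro sum_le_suminf summable_mult2) (auto simp: summable_geometric)
      also have "\<dots> = L / (1 - \<alpha>)"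
        using sums_unique[OF sums_mult2[OF geometric_sums[of \<alpha>], of L]] \<alpha>_pos \<alpha>_less_1 by simp
      finally have "(\<Sum>i<n. \<alpha> ^ i * expectation (\<lambda>\<omega>. myopic_profit (level \<pi> x (Suc i) \<omega>))) \<le> L / (1 - \<alpha>)" .
      moreover have "0 \<le> \<alpha> ^ n * (r * mean_backorder \<pi> x (Suc n))"
        using \<alpha>_pos r_pos mean_backorder_nonneg by simp
      ultimately show ?thesis
        using sum_expected_profit[OF int, of n] by (simp del: state.simps)
    qed
    then have "v \<le> r * real_of_int (neg x) + L / (1 - \<alpha>)"
      using v(2) unfolding sums_def by (intro LIMSEQ_le_const2) auto
    then show ?thesis
      using v(3) by simp
  next
    case False
    moreover have "enn2ereal a - enn2ereal b = - \<infinity>" if "a < \<infinity>" "\<not> b < \<infinity>" for a b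
      using that by (cases a; cases b) (auto simp: enn2ereal_ennreal)
    ultimately have "discounted_profit M D \<xi> \<alpha> r h \<pi> x = - \<infinity>"
      using A unfolding discounted_profit_eq by blast
    then show ?thesis by simp
  qed
qed

text \<open>The roles of the two parts are exchanged: now losses are bounded, and an infinite
  positive part makes the inequality trivial.\<close>

lemma discounted_profit_constant_level:
  assumes level: "\<And>i \<omega>. level \<pi> x (Suc i) \<omega> = s" and s: "0 \<le> myopic_profit s"
  shows "ereal (r * real_of_int (neg x) + myopic_profit s / (1 - \<alpha>)) \<le> discounted_profit M D \<xi> \<alpha> r h \<pi> x"
proof (cases "(\<integral>\<^sup>+\<omega>. (\<Sum>i. ennreal (\<alpha> ^ i * profit \<pi> x (Suc i) \<omega>)) \<partial>M) < \<infinity>")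
  case A: True
  let ?G = "\<lambda>i \<omega>. \<alpha> ^ i * profit \<pi> x (Suc i) \<omega>"
  have G_meas: "?G i \<in> borel_measurable M" for i
    by measurable
  \<comment> \<open>The discounted charge for the next backorder at level s; the other two terms of
    the profit are nonnegative.\<close>
  define K where "K = \<alpha> * r * (p * (mean_demand - mean_min_demand s))"
  have K: "0 \<le> K"
    unfolding K_def using \<alpha>_pos r_pos p_nonneg mean_min_demand_le_mean_demand by simp
  have "0 \<le> r * real_of_int (neg n)" for n
    using r_pos by simp
  then have "- profit \<pi> x (Suc i) \<omega> \<le> K" for i \<omega>
    unfolding one_period_profit_myopic level K_def using s by (smt (verit))
  then have le: "- ?G i \<omega> \<le> \<alpha> ^ i * K" for i \<omega>
    using \<alpha>_pos mult_left_mono[of "- profit \<pi> x (Suc i) \<omega>" K "\<alpha> ^ i"] by (simp del: state.simps)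
  have "(\<integral>\<^sup>+\<omega>. (\<Sum>i. ennreal (- ?G i \<omega>)) \<partial>M) \<le> (\<integral>\<^sup>+\<omega>. (\<Sum>i. ennreal (\<alpha> ^ i * K)) \<partial>M)"
    using le by (intro nn_integral_mono suminf_le ennreal_leI) auto
  also have "\<dots> = (\<Sum>i. ennreal (\<alpha> ^ i * K))"
    by (simp add: emeasure_space_1)
  also have "\<dots> < \<infinity>"
    unfolding infinity_ennreal_def less_top[symmetric]
    using summable_affine_discount[of \<alpha> K 0] \<alpha>_pos \<alpha>_less_1 K
    by (intro ennreal_suminf_neq_top) simp_all
  finally have B: "(\<integral>\<^sup>+\<omega>. (\<Sum>i. ennreal (- ?G i \<omega>)) \<partial>M) < \<infinity>" .
  obtain v where v: "\<And>i. integrable M (?G i)" "(\<lambda>i. expectation (?G i)) sums v"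
      "discounted_profit M D \<xi> \<alpha> r h \<pi> x = ereal v"
    by (rule expected_series_diff[OF G_meas A B, folded discounted_profit_eq]) (rule that)
  have int: "integrable M (profit \<pi> x (Suc i))" for i
    using v(1)[of i] \<alpha>_pos by (simp del: state.simps)
  \<comment> \<open>Majorant of the telescoping remainder; it tends to 0 as the general term of a
    summable series.\<close>
  let ?b = "\<lambda>n. \<alpha> ^ n * (r * real_of_int (neg x) + real n * (r * mean_demand))"
  have sum: "r * real_of_int (neg x) - ?b n + (\<Sum>i<n. \<alpha> ^ i) * myopic_profit s \<le> (\<Sum>i<n. expectation (?G i))" for n
  proof -
    have "\<alpha> ^ n * (r * mean_backorder \<pi> x (Suc n)) \<le> ?b n"
      using mult_left_mono[OF mean_backorder_le[of \<pi> x n], of r] r_pos \<alpha>_pos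
      by (intro mult_left_mono) (auto simp: algebra_simps)
    then show ?thesis
      using sum_expected_profit[OF int, of n] unfolding level
      by (simp del: state.simps add: prob_space sum_distrib_right)
  qed
  have "?b \<longlonglongrightarrow> 0"
    using \<alpha>_pos \<alpha>_less_1 by (intro summable_LIMSEQ_zero summable_affine_discount) auto
  moreover have "(\<lambda>n. \<Sum>i<n. \<alpha> ^ i) \<longlonglongrightarrow> 1 / (1 - \<alpha>)"
    using geometric_sums[of \<alpha>] \<alpha>_pos \<alpha>_less_1 by (simp add: sums_def)
  ultimately have "(\<lambda>n. r * real_of_int (neg x) - ?b n + (\<Sum>i<n. \<alpha> ^ i) * myopic_profit s)
      \<longlonglongrightarrow> r * real_of_int (neg x) - 0 + 1 / (1 - \<alpha>) * myopic_profit s"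
    by (intro tendsto_intros)
  moreover have "(\<lambda>n. \<Sum>i<n. expectation (?G i)) \<longlonglongrightarrow> v"
    using v(2) by (simp add: sums_def)
  ultimately have "r * real_of_int (neg x) - 0 + 1 / (1 - \<alpha>) * myopic_profit s \<le> v"
    by (rule LIMSEQ_le) (use sum in blast)
  then show ?thesis
    using v(3) by simp
next
  case False
  moreover have "enn2ereal a - enn2ereal b = \<infinity>" if "\<not> a < \<infinity>" for a b
    using that by (cases a; cases b) (auto simp: enn2ereal_ennreal)
  ultimately have "discounted_profit M D \<xi> \<alpha> r h \<pi> x = \<infinity>"
    unfolding discounted_profit_eq by blast
  then show ?thesis by simp
qed

section \<open>The optimal profit\<close>

text \<open>The first profit is a real constant, so it can be pulled out even if the rest is
  infinite. This lets two policies with the same future be compared without any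
  integrability.\<close>

lemma discounted_profit_split_first:
  "discounted_profit M D \<xi> \<alpha> r h \<pi> x = ereal (one_period_profit M D r h x (\<pi> 1 x))
     + (enn2ereal (\<integral>\<^sup>+\<omega>. (\<Sum>i. ennreal (\<alpha> ^ Suc i * profit \<pi> x (Suc (Suc i)) \<omega>)) \<partial>M)
      - enn2ereal (\<integral>\<^sup>+\<omega>. (\<Sum>i. ennreal (- (\<alpha> ^ Suc i * profit \<pi> x (Suc (Suc i)) \<omega>))) \<partial>M))"
proof -
  let ?g = "one_period_profit M D r h x (\<pi> 1 x)"
  \<comment> \<open>Taking c = 1 and c = -1 treats the gains and the losses at once.\<close>
  have split: "(\<integral>\<^sup>+\<omega>. (\<Sum>i. ennreal (c * (\<alpha> ^ i * profit \<pi> x (Suc i) \<omega>))) \<partial>M)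
      = ennreal (c * ?g) + (\<integral>\<^sup>+\<omega>. (\<Sum>i. ennreal (c * (\<alpha> ^ Suc i * profit \<pi> x (Suc (Suc i)) \<omega>))) \<partial>M)" for c
  proof -
    have "(\<Sum>i. ennreal (c * (\<alpha> ^ i * profit \<pi> x (Suc i) \<omega>)))
      = ennreal (c * ?g) + (\<Sum>i. ennreal (c * (\<alpha> ^ Suc i * profit \<pi> x (Suc (Suc i)) \<omega>)))" for \<omega>
      by (subst suminf_offset[of _ 1]) (auto simp: add.commute)
    then show ?thesis
      by (simp add: nn_integral_add emeasure_space_1 del: state.simps power_Suc)
  qed
  have "enn2ereal (ennreal g + A) - enn2ereal (ennreal (- g) + B) = ereal g + (enn2ereal A - enn2ereal B)"
    for g A B
    by (cases A; cases B; cases "0 \<le> g")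
      (auto simp: plus_ennreal.rep_eq enn2ereal_ennreal ennreal_neg)
  then show ?thesis
    unfolding discounted_profit_eq using split[of 1] split[of "-1"] by (simp del: state.simps power_Suc)
qed

lemma optimal_profit_o_step:
  "optimal_profit_o M D \<xi> \<alpha> r h (x + 1) \<le> optimal_profit_o M D \<xi> \<alpha> r h x"
proof -
  \<comment> \<open>The revenue from filling one more backorder: r if x < 0, else 0. Subtracting r
    x^- in \<open>optimal_profit_o\<close> cancels it exactly.\<close>
  define \<delta> where "\<delta> = r * real_of_int (neg x) - r * real_of_int (neg (x + 1))"
  have le: "discounted_profit M D \<xi> \<alpha> r h \<pi> (x + 1) \<le> optimal_profit M D \<xi> \<alpha> r h x - ereal \<delta>" for \<pi>
  proof -
    \<comment> \<open>In period 1 the state is known to be x, so one unit more than the order of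
      \<pi> at x + 1 leads to the same level; from period 2 on the two systems coincide.\<close>
    define \<pi>' where "\<pi>' = (\<lambda>i n. if i = 1 then \<pi> 1 (x + 1) + 1 else \<pi> i n)"
    have state: "state D \<xi> \<pi>' x (Suc (Suc i)) \<omega> = state D \<xi> \<pi> (x + 1) (Suc (Suc i)) \<omega>" for i \<omega>
    proof (induction i)
      case (Suc i)
      then show ?case
        by (simp only: state.simps(2)[of _ _ _ _ "Suc (Suc i)"]) (simp add: \<pi>'_def del: state.simps)
    qed (simp add: \<pi>'_def ac_simps)
    have tail: "profit \<pi>' x (Suc (Suc i)) \<omega> = profit \<pi> (x + 1) (Suc (Suc i)) \<omega>" for i \<omega>
      unfolding state by (simp add: \<pi>'_def)
    have first: "one_period_profit M D r h x (\<pi>' 1 x)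
        = one_period_profit M D r h (x + 1) (\<pi> 1 (x + 1)) + \<delta>"
      unfolding one_period_profit_eq by (simp add: \<pi>'_def \<delta>_def ac_simps)
    have "discounted_profit M D \<xi> \<alpha> r h \<pi>' x = discounted_profit M D \<xi> \<alpha> r h \<pi> (x + 1) + ereal \<delta>"
      unfolding discounted_profit_split_first tail first plus_ereal.simps(1)[symmetric] by (simp only: ac_simps)
    then have "discounted_profit M D \<xi> \<alpha> r h \<pi> (x + 1) + ereal \<delta> \<le> optimal_profit M D \<xi> \<alpha> r h x"
      unfolding optimal_profit_def by (metis SUP_upper UNIV_I)
    then show ?thesis
      by (simp add: ereal_le_minus)
  qed
  have "optimal_profit M D \<xi> \<alpha> r h (x + 1) \<le> optimal_profit M D \<xi> \<alpha> r h x - ereal \<delta>"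
    unfolding optimal_profit_def[of _ _ _ _ _ _ "x + 1"] using le by (intro SUP_least)
  then have "optimal_profit_o M D \<xi> \<alpha> r h (x + 1)
      \<le> optimal_profit M D \<xi> \<alpha> r h x - ereal \<delta> - ereal (r * real_of_int (neg (x + 1)))"
    unfolding optimal_profit_o_def by (intro ereal_minus_mono) auto
  also have "\<dots> = optimal_profit_o M D \<xi> \<alpha> r h x"
    unfolding optimal_profit_o_def by (cases "optimal_profit M D \<xi> \<alpha> r h x") (auto simp: \<delta>_def)
  finally show ?thesis .
qed

lemma quasi_concave_antimono:
  assumes "antimono f" shows "quasi_concave f"
  unfolding quasi_concave_def by (meson assms antimonoD min.coboundedI2)

lemma antimono_optimal_profit_o: "antimono (optimal_profit_o M D \<xi> \<alpha> r h)"
proof (rule antimonoI)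
  fix x y :: int
  assume "x \<le> y"
  then show "optimal_profit_o M D \<xi> \<alpha> r h y \<le> optimal_profit_o M D \<xi> \<alpha> r h x"
    by (induction y rule: int_ge_induct) (auto intro: order_trans[OF optimal_profit_o_step])
qed

lemma optimal_profit_o_le:
  assumes "\<And>y. myopic_profit y \<le> L"
  shows "optimal_profit_o M D \<xi> \<alpha> r h x \<le> ereal (L / (1 - \<alpha>))"
proof -
  have "optimal_profit M D \<xi> \<alpha> r h x \<le> ereal (r * real_of_int (neg x) + L / (1 - \<alpha>))"
    unfolding optimal_profit_def using discounted_profit_le[OF assms] by (intro SUP_least)
  then show ?thesis
    unfolding optimal_profit_o_def by (cases "optimal_profit M D \<xi> \<alpha> r h x") auto
qed

lemma optimal_profit_o_ge:
  assumes "\<And>y. myopic_profit y \<le> myopic_profit s"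
  shows "ereal (myopic_profit s / (1 - \<alpha>)) \<le> optimal_profit_o M D \<xi> \<alpha> r h s"
proof -
  \<comment> \<open>Needed so that \<open>next_state_le\<close> bounds the next state by s itself
    and not merely by \<open>pos s\<close>.\<close>
  have "0 \<le> s"
    using myopic_profit_negative[of s] assms[of 0] by (cases "s < 0") auto
  define \<pi> where "\<pi> = (\<lambda>(i :: nat) n. nat (s - n))"
  have state_le: "state D \<xi> \<pi> s i \<omega> \<le> s" for i \<omega>
  proof (induction i)
    case (Suc i)
    then show ?case
      using next_state_le[of s "D i \<omega>" "\<lambda>l. \<xi> i l \<omega>"] \<open>0 \<le> s\<close> by (simp add: \<pi>_def)
  qed simp
  have "level \<pi> s (Suc i) \<omega> = s" for i \<omega>
    unfolding \<pi>_def using state_le[of "Suc i" \<omega>] by (simp add: \<pi>_def del: state.simps)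
  moreover have "0 \<le> myopic_profit s"
    using assms[of 0] myopic_profit_0_nonneg by linarith
  ultimately have "ereal (r * real_of_int (neg s) + myopic_profit s / (1 - \<alpha>))
      \<le> discounted_profit M D \<xi> \<alpha> r h \<pi> s"
    by (rule discounted_profit_constant_level)
  also have "\<dots> \<le> optimal_profit M D \<xi> \<alpha> r h s"
    unfolding optimal_profit_def by (rule SUP_upper) simp
  finally show ?thesis
    unfolding optimal_profit_o_def by (cases "optimal_profit M D \<xi> \<alpha> r h s") auto
qed

end

text \<open>The maximizers are related by an inclusion: \<open>optimal_profit_o\<close> is
  antimonotone, so every x \<le> s maximizes it as well, whereas negative levels never maximize
  \<open>one_period_profit_o\<close>.\<close>

theorem proposition3:
  fixes M :: "'a measure" and D :: "nat \<Rightarrow> 'a \<Rightarrow> nat" and \<xi> :: "nat \<Rightarrow> nat \<Rightarrow> 'a \<Rightarrow> nat"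
    and r h p \<alpha> :: real
  assumes "prob_space M"
    and "r > 0" and "h > 0" and "0 \<le> p" and "p \<le> 1" and "0 < \<alpha>" and "\<alpha> < 1"
    and demand_distr: "\<And>i. i \<ge> 1 \<Longrightarrow>
          distr M (count_space UNIV) (D i) = distr M (count_space UNIV) (D 1)"
    and demand_mean: "integrable M (\<lambda>\<omega>. real (D 1 \<omega>))"
    and patience_distr: "\<And>i l. i \<ge> 1 \<Longrightarrow> l \<ge> 1 \<Longrightarrow>
          distr M (count_space UNIV) (\<xi> i l) = measure_pmf (map_pmf of_bool (bernoulli_pmf p))"
    and indep: "prob_space.indep_vars M (\<lambda>_. count_space UNIV)
          (case_sum D (\<lambda>(i, l). \<xi> i l)) ({1..} <+> {1..} \<times> {1..})"
  shows "quasi_concave (one_period_profit_o M D \<xi> \<alpha> r h)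
    \<and> quasi_concave (optimal_profit_o M D \<xi> \<alpha> r h)
    \<and> (\<exists>s. is_arg_max (one_period_profit_o M D \<xi> \<alpha> r h) (\<lambda>_. True) s)
    \<and> (\<forall>s. is_arg_max (one_period_profit_o M D \<xi> \<alpha> r h) (\<lambda>_. True) s \<longrightarrow>
           is_arg_max (optimal_profit_o M D \<xi> \<alpha> r h) (\<lambda>_. True) s)"
proof -
  interpret prob_space M by fact
  interpret partial_backorder M D \<xi> r h p \<alpha>
    by unfold_locales (fact assms)+
  have "optimal_profit_o M D \<xi> \<alpha> r h y \<le> optimal_profit_o M D \<xi> \<alpha> r h s"
    if "\<And>y. myopic_profit y \<le> myopic_profit s" for s y
    using optimal_profit_o_le[OF that] optimal_profit_o_ge[OF that] by (rule order_trans)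
  then show ?thesis
    using quasi_concave_myopic_profit quasi_concave_antimono[OF antimono_optimal_profit_o]
      myopic_profit_has_max
    by (auto simp: is_arg_max_linorder)
qed

end
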